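(* Let $(X,d,\mu)$ be a space of homogeneous type, let $\delta$ be the quasi-metric on $X$ associated with $(X,d,\mu)$ as defined in the context, let $s\ge 0$, and let $F$ be a closed subset of $X$. (1) If $F$ is an unbounded $s$-set in $(X,d,\mu)$, then $F$ is an $s$-set in $(X,\delta)$. (2) If $F$ is locally an $s$-set in $(X,d,\mu)$ and $F$ is consistent with $\mu$, then $F$ is locally an $s$-set in $(X,\delta)$.
   Context: A quasi-metric on a set $X$ is a function $d:X\times X\to[0,\infty)$ with $d(x,y)=0$ iff $x=y$, $d(x,y)=d(y,x)$, and $d(x,y)\le K(d(x,z)+d(z,y))$ for all $x,y,z\in X$, for some constant $K\ge 1$ (the triangle constant of $d$). Write $B(x,r)=\{y\in X: d(x,y)<r\}$, $r>0$, for the $d$-balls. The topology on $X$ is the one induced by $d$: its neighborhood system is given by the sets containing a $d$-ball; it is assumed that the $d$-balls are open sets. For $E\subseteq X$, $\mathrm{diam}(E)=\sup\{d(x,y):x,y\in E\}$; $E$ is bounded if $\mathrm{diam}(E)<\infty$ and unbounded if $\mathrm{diam}(E)=\infty$. A Borel measure $\mu$ is doubling if there is a constant $A\ge 1$ with $0<\mu(B(x,2r))\le A\mu(B(x,r))<\infty$ for all $x\in X$, $r>0$; it is non-atomic if $\mu(\{x\})=0$ for all $x\in X$. $(X,d,\mu)$ is a space of homogeneous type if $\mu$ is a non-atomic doubling measure on the quasi-metric space $(X,d)$. The quasi-metric $\delta$ (Macías–Segovia) is defined by $\delta(x,y)=\inf\{\mu(B): B \text{ is a } d\text{-ball with } x,y\in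 B\}$ if $x\ne y$, and $\delta(x,x)=0$. It is known that $\delta$ is a quasi-metric inducing the same topology as $d$. Write $B_\delta(x,r)=\{y\in X:\delta(x,y)<r\}$ and $\mathrm{diam}_\delta(E)=\sup\{\delta(y,w):y,w\in E\}$. A closed set $F\subseteq X$ is an $s$-set in $(X,\delta)$ if there exist a Borel measure $\nu$ supported on $F$ and a constant $c\ge 1$ such that $c^{-1}r^s\le \nu(B_\delta(x,r))\le c r^s$ for every $x\in F$ and every $0<r<\mathrm{diam}_\delta(F)$. It is locally an $s$-set in $(X,\delta)$ if such $\nu$ and $c$ exist with these inequalities holding for every $x\in F$ and every $0<r<r_0$, for some positive number $r_0<\mathrm{diam}_\delta(F)$. A closed set $F\subseteq X$ is an $s$-set in $(X,d,\mu)$ if there exist a Borel measure $m$ supported on $F$ and a constant $c\ge 1$ such that $c^{-1}\mu(B(x,r))^s\le m(B(x,r))\le c\,\mu(B(x,r))^s$ for every $x\in F$ and every $0<r<\mathrm{diam}(F)$. It is locally an $s$-set in $(X,d,\mu)$ if such $m$ and $c$ exist with these inequalities holding for every $x\in F$ and every $0<r<r_0$, for some positive number $r_0<\mathrm{diam}(F)$. A closed set $F\subseteq X$ is consistent with $\mu$ if there exists a positive number $R$ such that $\inf_{x\in F}\mu(B(x,R))>0$. *)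

theory Defs
  imports "HOL-Analysis.Analysis"
begin

definition quasi_metric_on :: "'a set \<Rightarrow> ('a \<Rightarrow> 'a \<Rightarrow> real) \<Rightarrow> bool" where
  "quasi_metric_on X d \<longleftrightarrow>
     (\<forall>x\<in>X. \<forall>y\<in>X. 0 \<le> d x y \<and> (d x y = 0 \<longleftrightarrow> x = y) \<and> d x y = d y x) \<and>
     (\<exists>K\<ge>1. \<forall>x\<in>X. \<forall>y\<in>X. \<forall>z\<in>X. d x y \<le> K * (d x z + d z y))"

definition qm_ball :: "'a set \<Rightarrow> ('a \<Rightarrow> 'a \<Rightarrow> real) \<Rightarrow> 'a \<Rightarrow> real \<Rightarrow> 'a set" where
  "qm_ball X d x r = {y\<in>X. d x y < r}"

(* A set is open iff it is a neighbourhood of each of its points, i.e. contains a ball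
   centred at each of its points.  In general the balls themselves need not be open. *)
definition qm_topology :: "'a set \<Rightarrow> ('a \<Rightarrow> 'a \<Rightarrow> real) \<Rightarrow> 'a topology" where
  "qm_topology X d = topology (\<lambda>U. U \<subseteq> X \<and> (\<forall>x\<in>U. \<exists>r>0. qm_ball X d x r \<subseteq> U))"

lemma openin_qm_topology:
  "openin (qm_topology X d) U \<longleftrightarrow> U \<subseteq> X \<and> (\<forall>x\<in>U. \<exists>r>0. qm_ball X d x r \<subseteq> U)"
proof -
  have "istopology (\<lambda>U. U \<subseteq> X \<and> (\<forall>x\<in>U. \<exists>r>0. qm_ball X d x r \<subseteq> U))"
    unfolding istopology_def
  proof (intro conjI allI impI ballI)
    fix S T x
    assume S: "S \<subseteq> X \<and> (\<forall>x\<in>S. \<exists>r>0. qm_ball X d x r \<subseteq> S)"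
      and T: "T \<subseteq> X \<and> (\<forall>x\<in>T. \<exists>r>0. qm_ball X d x r \<subseteq> T)"
    show "S \<inter> T \<subseteq> X" using S by blast
    assume "x \<in> S \<inter> T"
    with S T obtain r t where "r > 0" "qm_ball X d x r \<subseteq> S" "t > 0" "qm_ball X d x t \<subseteq> T"
      by blast
    then show "\<exists>r>0. qm_ball X d x r \<subseteq> S \<inter> T"
      by (intro exI[of _ "min r t"]) (auto simp: qm_ball_def)
  next
    fix \<K> x
    assume K: "\<forall>S\<in>\<K>. S \<subseteq> X \<and> (\<forall>x\<in>S. \<exists>r>0. qm_ball X d x r \<subseteq> S)"
    then show "\<Union>\<K> \<subseteq> X" by blast
    assume "x \<in> \<Union>\<K>"
    with K show "\<exists>r>0. qm_ball X d x r \<subseteq> \<Union>\<K>"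
      by (meson Union_iff Union_upper order_trans)
  qed
  then show ?thesis
    by (simp add: qm_topology_def topology_inverse')
qed

lemma topspace_qm_topology: "topspace (qm_topology X d) = X"
proof -
  have "openin (qm_topology X d) X"
    by (auto simp: openin_qm_topology qm_ball_def intro: exI[of _ 1])
  moreover have "topspace (qm_topology X d) \<subseteq> X"
    using openin_topspace[of "qm_topology X d"] unfolding openin_qm_topology by blast
  ultimately show ?thesis
    using openin_subset[of "qm_topology X d" X] by blast
qed

definition borel_measure_on :: "'a topology \<Rightarrow> 'a measure \<Rightarrow> bool" where
  "borel_measure_on T M \<longleftrightarrow>
     space M = topspace T \<and> sets M = sigma_sets (topspace T) {U. openin T U}"

definition supported_on :: "'a measure \<Rightarrow> 'a set \<Rightarrow> bool" where
  "supported_on M F \<longleftrightarrow> emeasure M (space M - F) = 0"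

definition qm_diam :: "('a \<Rightarrow> 'a \<Rightarrow> real) \<Rightarrow> 'a set \<Rightarrow> ennreal" where
  "qm_diam d E = (SUP x\<in>E. SUP y\<in>E. ennreal (d x y))"

definition qm_unbounded :: "('a \<Rightarrow> 'a \<Rightarrow> real) \<Rightarrow> 'a set \<Rightarrow> bool" where
  "qm_unbounded d E \<longleftrightarrow> qm_diam d E = \<infinity>"

definition doubling :: "'a set \<Rightarrow> ('a \<Rightarrow> 'a \<Rightarrow> real) \<Rightarrow> 'a measure \<Rightarrow> bool" where
  "doubling X d M \<longleftrightarrow>
     (\<exists>A::real. A \<ge> 1 \<and> (\<forall>x\<in>X. \<forall>r>0.
        0 < emeasure M (qm_ball X d x (2 * r)) \<and>
        emeasure M (qm_ball X d x (2 * r)) \<le> ennreal A * emeasure M (qm_ball X d x r) \<and>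
        ennreal A * emeasure M (qm_ball X d x r) < \<infinity>))"

definition non_atomic :: "'a set \<Rightarrow> 'a measure \<Rightarrow> bool" where
  "non_atomic X M \<longleftrightarrow> (\<forall>x\<in>X. emeasure M {x} = 0)"

(* The second conjunct is the standing assumption that d-balls are open; it makes them
   (and singletons) Borel, so that the values of M below are not default values. *)
definition space_of_homogeneous_type ::
    "'a set \<Rightarrow> ('a \<Rightarrow> 'a \<Rightarrow> real) \<Rightarrow> 'a measure \<Rightarrow> bool" where
  "space_of_homogeneous_type X d M \<longleftrightarrow>
     quasi_metric_on X d \<and>
     (\<forall>x\<in>X. \<forall>r>0. openin (qm_topology X d) (qm_ball X d x r)) \<and>
     borel_measure_on (qm_topology X d) M \<and>
     doubling X d M \<and> non_atomic X M"

(* Macias-Segovia quasi-metric.  The infimum runs over all d-balls containing x and y,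
   with arbitrary centre; in a space of homogeneous type these have finite measure and
   there is at least one, so the real-valued infimum is the intended one. *)
definition ms_delta :: "'a set \<Rightarrow> ('a \<Rightarrow> 'a \<Rightarrow> real) \<Rightarrow> 'a measure \<Rightarrow> 'a \<Rightarrow> 'a \<Rightarrow> real" where
  "ms_delta X d M x y =
     (if x = y then 0
      else Inf {measure M (qm_ball X d z r) | z r.
                  z \<in> X \<and> r > 0 \<and> x \<in> qm_ball X d z r \<and> y \<in> qm_ball X d z r})"

(* s-sets in a quasi-metric space (X, e).  Closed and Borel refer to the topology of e,
   which for e = ms_delta X d M coincides with that of d. *)
definition s_set :: "'a set \<Rightarrow> ('a \<Rightarrow> 'a \<Rightarrow> real) \<Rightarrow> real \<Rightarrow> 'a set \<Rightarrow> bool" where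
  "s_set X e s F \<longleftrightarrow>
     closedin (qm_topology X e) F \<and>
     (\<exists>\<nu> (c::real). borel_measure_on (qm_topology X e) \<nu> \<and> supported_on \<nu> F \<and> c \<ge> 1 \<and>
        (\<forall>x\<in>F. \<forall>r>0. ennreal r < qm_diam e F \<longrightarrow>
           ennreal (inverse c * r powr s) \<le> emeasure \<nu> (qm_ball X e x r) \<and>
           emeasure \<nu> (qm_ball X e x r) \<le> ennreal (c * r powr s)))"

definition locally_s_set :: "'a set \<Rightarrow> ('a \<Rightarrow> 'a \<Rightarrow> real) \<Rightarrow> real \<Rightarrow> 'a set \<Rightarrow> bool" where
  "locally_s_set X e s F \<longleftrightarrow>
     closedin (qm_topology X e) F \<and>
     (\<exists>\<nu> (c::real) r0. borel_measure_on (qm_topology X e) \<nu> \<and> supported_on \<nu> F \<and> c \<ge> 1 \<and>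
        r0 > 0 \<and> ennreal r0 < qm_diam e F \<and>
        (\<forall>x\<in>F. \<forall>r>0. r < r0 \<longrightarrow>
           ennreal (inverse c * r powr s) \<le> emeasure \<nu> (qm_ball X e x r) \<and>
           emeasure \<nu> (qm_ball X e x r) \<le> ennreal (c * r powr s)))"

definition s_set_wrt ::
    "'a set \<Rightarrow> ('a \<Rightarrow> 'a \<Rightarrow> real) \<Rightarrow> 'a measure \<Rightarrow> real \<Rightarrow> 'a set \<Rightarrow> bool" where
  "s_set_wrt X d M s F \<longleftrightarrow>
     closedin (qm_topology X d) F \<and>
     (\<exists>m (c::real). borel_measure_on (qm_topology X d) m \<and> supported_on m F \<and> c \<ge> 1 \<and>
        (\<forall>x\<in>F. \<forall>r>0. ennreal r < qm_diam d F \<longrightarrow>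
           ennreal (inverse c * measure M (qm_ball X d x r) powr s)
             \<le> emeasure m (qm_ball X d x r) \<and>
           emeasure m (qm_ball X d x r)
             \<le> ennreal (c * measure M (qm_ball X d x r) powr s)))"

definition locally_s_set_wrt ::
    "'a set \<Rightarrow> ('a \<Rightarrow> 'a \<Rightarrow> real) \<Rightarrow> 'a measure \<Rightarrow> real \<Rightarrow> 'a set \<Rightarrow> bool" where
  "locally_s_set_wrt X d M s F \<longleftrightarrow>
     closedin (qm_topology X d) F \<and>
     (\<exists>m (c::real) r0. borel_measure_on (qm_topology X d) m \<and> supported_on m F \<and> c \<ge> 1 \<and>
        r0 > 0 \<and> ennreal r0 < qm_diam d F \<and>
        (\<forall>x\<in>F. \<forall>r>0. r < r0 \<longrightarrow>
           ennreal (inverse c * measure M (qm_ball X d x r) powr s)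
             \<le> emeasure m (qm_ball X d x r) \<and>
           emeasure m (qm_ball X d x r)
             \<le> ennreal (c * measure M (qm_ball X d x r) powr s)))"

definition consistent_with ::
    "'a set \<Rightarrow> ('a \<Rightarrow> 'a \<Rightarrow> real) \<Rightarrow> 'a measure \<Rightarrow> 'a set \<Rightarrow> bool" where
  "consistent_with X d M F \<longleftrightarrow>
     closedin (qm_topology X d) F \<and>
     (\<exists>R>0. 0 < (INF x\<in>F. emeasure M (qm_ball X d x R)))"

end

theory Submission
  imports Defs
begin

text \<open>
  The function \<open>y \<mapsto> \<mu>(B(x, d(x,y)))\<close> is comparable to \<open>\<delta>(x,y)\<close>, and \<open>\<mu>(B(x,t))\<close> tends to 0 as
  \<open>t \<rightarrow> 0\<close> and at most changes by the factor \<open>A\<close> when \<open>t\<close> is doubled.  Hence a \<open>\<delta>\<close>-ball of radius \<open>r\<close>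
  at \<open>x\<close> lies between two \<open>d\<close>-balls at \<open>x\<close> of measure comparable to \<open>r\<close>, as soon as some ball
  \<open>B(x,T)\<close> with \<open>T\<close> in the admissible range has measure at least a constant times \<open>r\<close>.  In the
  unbounded case there is always such a \<open>T\<close>, because \<open>\<mu>(X) = \<infinity>\<close>; in the local case consistency
  provides it for all small \<open>r\<close>, uniformly in \<open>x\<close>.
\<close>

text \<open>The existentially quantified constants become fixed parameters. Doubling is phrased with
  the real-valued \<open>measure\<close>, which is faithful because every ball has finite
  measure.\<close>

locale homogeneous_space =
  fixes X :: "'a set" and d :: "'a \<Rightarrow> 'a \<Rightarrow> real" and M :: "'a measure" and K A :: real
  assumes dist_nonneg: "x \<in> X \<Longrightarrow> y \<in> X \<Longrightarrow> 0 \<le> d x y"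
    and dist_eq_0: "x \<in> X \<Longrightarrow> y \<in> X \<Longrightarrow> d x y = 0 \<longleftrightarrow> x = y"
    and dist_sym: "x \<in> X \<Longrightarrow> y \<in> X \<Longrightarrow> d x y = d y x"
    and K_ge_1: "K \<ge> 1"
    and dist_triangle: "x \<in> X \<Longrightarrow> y \<in> X \<Longrightarrow> z \<in> X \<Longrightarrow> d x y \<le> K * (d x z + d z y)"
    and openin_ball: "x \<in> X \<Longrightarrow> r > 0 \<Longrightarrow> openin (qm_topology X d) (qm_ball X d x r)"
    and borel: "borel_measure_on (qm_topology X d) M"
    and A_ge_1: "A \<ge> 1"
    and measure_ball_double:
      "x \<in> X \<Longrightarrow> r > 0 \<Longrightarrow>
         measure M (qm_ball X d x (2 * r)) \<le> A * measure M (qm_ball X d x r)"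
    and measure_ball_pos: "x \<in> X \<Longrightarrow> r > 0 \<Longrightarrow> 0 < measure M (qm_ball X d x r)"
    and emeasure_ball_finite: "x \<in> X \<Longrightarrow> r > 0 \<Longrightarrow> emeasure M (qm_ball X d x r) < \<infinity>"
    and emeasure_singleton: "x \<in> X \<Longrightarrow> emeasure M {x} = 0"
begin

section \<open>Balls and their measures\<close>

abbreviation B :: "'a \<Rightarrow> real \<Rightarrow> 'a set" where "B \<equiv> qm_ball X d"

abbreviation mu :: "'a \<Rightarrow> real \<Rightarrow> real" where "mu x r \<equiv> measure M (B x r)"

abbreviation delta :: "'a \<Rightarrow> 'a \<Rightarrow> real" where "delta \<equiv> ms_delta X d M"

lemma sets_openin:
  assumes "borel_measure_on (qm_topology X d) m" "openin (qm_topology X d) U"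
  shows "U \<in> sets m"
  using assms by (auto simp: borel_measure_on_def intro: sigma_sets.Basic)

lemma fmeasurable_ball: "x \<in> X \<Longrightarrow> r > 0 \<Longrightarrow> B x r \<in> fmeasurable M"
  using emeasure_ball_finite sets_openin[OF borel openin_ball] by (auto intro!: fmeasurableI)

lemma mu_mono:
  assumes "B x r \<subseteq> B y t" "x \<in> X" "y \<in> X" "r > 0" "t > 0"
  shows "mu x r \<le> mu y t"
  using assms by (intro measure_mono_fmeasurable) (auto simp: fmeasurable_ball fmeasurableD)

lemma ball_mono: "r \<le> t \<Longrightarrow> B x r \<subseteq> B x t"
  by (auto simp: qm_ball_def)

lemma centre_in_ball: "x \<in> X \<Longrightarrow> r > 0 \<Longrightarrow> x \<in> B x r"
  using dist_eq_0[of x x] by (auto simp: qm_ball_def)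

lemma dist_pos: "x \<in> X \<Longrightarrow> y \<in> X \<Longrightarrow> x \<noteq> y \<Longrightarrow> 0 < d x y"
  using dist_nonneg[of x y] dist_eq_0[of x y] by linarith

lemma mu_double_pow:
  assumes "x \<in> X" "r > 0"
  shows "mu x (2 ^ n * r) \<le> A ^ n * mu x r"
proof (induction n)
  case (Suc n)
  have "mu x (2 * (2 ^ n * r)) \<le> A * mu x (2 ^ n * r)"
    using assms by (intro measure_ball_double) auto
  also have "\<dots> \<le> A * (A ^ n * mu x r)"
    using Suc A_ge_1 by (intro mult_left_mono) auto
  finally show ?case by (simp add: mult.assoc)
qed simp

text \<open>Rounding \<open>l\<close> up to a power of 2 and iterating doubling gives a factor that
  depends on \<open>l\<close> only, not on the centre or the radius.\<close>

lemma mu_dilate: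
  assumes "l > 0"
  obtains C where "C \<ge> 1" "\<And>x r. x \<in> X \<Longrightarrow> r > 0 \<Longrightarrow> mu x (l * r) \<le> C * mu x r"
proof -
  obtain n :: nat where n: "l < 2 ^ n"
    using real_arch_pow[of 2 l] by auto
  have "mu x (l * r) \<le> A ^ n * mu x r" if "x \<in> X" "r > 0" for x r
  proof -
    have "mu x (l * r) \<le> mu x (2 ^ n * r)"
      using that n assms by (intro mu_mono ball_mono) auto
    with mu_double_pow[OF that, of n] show ?thesis by linarith
  qed
  then show thesis using A_ge_1 by (intro that[of "A ^ n"]) auto
qed

text \<open>The balls decrease to \<open>{x}\<close>, which is a null set by non-atomicity;
  continuity from above applies since the balls have finite measure.\<close>

lemma mu_tendsto_0:
  assumes "x \<in> X" "T > 0"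
  shows "(\<lambda>n. mu x (T / 2 ^ n)) \<longlonglongrightarrow> 0"
proof -
  have lim0: "(\<lambda>n. T / 2 ^ n) \<longlonglongrightarrow> 0"
    by (intro LIMSEQ_divide_realpow_zero) simp
  have int: "(\<Inter>n. B x (T / 2 ^ n)) = {x}"
  proof
    show "{x} \<subseteq> (\<Inter>n. B x (T / 2 ^ n))"
      using assms centre_in_ball by auto
    show "(\<Inter>n. B x (T / 2 ^ n)) \<subseteq> {x}"
    proof
      fix y assume y: "y \<in> (\<Inter>n. B x (T / 2 ^ n))"
      then have yX: "y \<in> X" and less: "\<And>n. d x y < T / 2 ^ n"
        by (auto simp: qm_ball_def)
      from lim0 have "d x y \<le> 0"
        by (rule LIMSEQ_le_const) (use less in \<open>auto intro: less_imp_le\<close>)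
      then show "y \<in> {x}"
        using dist_pos[OF assms(1) yX] by auto
    qed
  qed
  have "(\<lambda>n. measure M (B x (T / 2 ^ n))) \<longlonglongrightarrow> measure M (\<Inter>n. B x (T / 2 ^ n))"
  proof (rule Lim_measure_decseq)
    show "range (\<lambda>n. B x (T / 2 ^ n)) \<subseteq> sets M"
      using assms by (auto intro!: fmeasurableD fmeasurable_ball)
    show "decseq (\<lambda>n. B x (T / 2 ^ n))"
      using assms by (intro decseq_SucI ball_mono) (auto simp: field_simps)
    show "emeasure M (B x (T / 2 ^ n)) \<noteq> \<infinity>" for n
      using emeasure_ball_finite[of x "T / 2 ^ n"] assms by auto
  qed
  then show ?thesis
    unfolding int using emeasure_singleton[OF assms(1)] by (simp add: measure_def)
qed

text \<open>Halve \<open>T\<close> until the measure drops below \<open>r\<close>, and take the step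
  at which this happens. By doubling, both \<open>mu x t\<close> and \<open>mu x (2 * t)\<close> are
  then comparable to \<open>r\<close>.\<close>

lemma scale_exists:
  assumes "x \<in> X" "T > 0" "r > 0" "r \<le> mu x T"
  obtains t where "t > 0" "2 * t \<le> T" "mu x t < r" "r \<le> mu x (2 * t)"
proof -
  define P where "P n \<longleftrightarrow> mu x (T / 2 ^ n) < r" for n :: nat
  have "\<exists>n. P n"
    using order_tendstoD(2)[OF mu_tendsto_0[OF assms(1,2)] assms(3)]
    by (auto simp: P_def eventually_sequentially)
  moreover have "\<not> P 0" using assms by (simp add: P_def)
  \<comment> \<open>Induction read backwards: a property that fails at 0 and holds somewhere must
    switch between some \<open>k\<close> and \<open>Suc k\<close>.\<close>
  ultimately obtain k where k: "\<not> P k" "P (Suc k)"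
    using nat.induct[of "\<lambda>n. \<not> P n"] by blast
  have "1 * T \<le> 2 ^ k * T"
    using assms(2) by (intro mult_right_mono) auto
  then show thesis
    using k assms(2) by (intro that[of "T / 2 ^ Suc k"]) (auto simp: P_def field_simps)
qed

section \<open>The quasi-metric \<open>delta\<close> and its topology\<close>

lemma bdd_below_balls: "bdd_below {measure M (B z r) | z r. P z r}"
  by (rule bdd_belowI[of _ 0]) auto

lemma delta_le:
  assumes "z \<in> X" "r > 0" "x \<in> B z r" "y \<in> B z r"
  shows "delta x y \<le> mu z r"
proof (cases "x = y")
  case False
  then show ?thesis
    unfolding ms_delta_def using assms
    by (auto intro!: cInf_lower bdd_below_balls)
qed (simp add: ms_delta_def)

text \<open>The real \<open>Inf\<close> in \<open>ms_delta\<close> is meaningful only over a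
  nonempty set; a ball centred at \<open>x\<close> of radius slightly above \<open>d x y\<close>
  provides a member.\<close>

lemma balls_containing_nonempty:
  assumes "x \<in> X" "y \<in> X"
  shows "{mu z r | z r. z \<in> X \<and> r > 0 \<and> x \<in> B z r \<and> y \<in> B z r} \<noteq> {}"
proof -
  have r: "d x y + 1 > 0" using dist_nonneg[OF assms] by simp
  have "mu x (d x y + 1) \<in> {mu z r | z r. z \<in> X \<and> r > 0 \<and> x \<in> B z r \<and> y \<in> B z r}"
    using r assms centre_in_ball[OF assms(1) r]
    by (intro CollectI exI[of _ x] exI[of _ "d x y + 1"]) (auto simp: qm_ball_def)
  then show ?thesis by blast
qed

text \<open>Every ball that contains \<open>x\<close> and \<open>y\<close> has, after dilation by a
  fixed factor, \<open>B x (d x y)\<close> inside it. Doubling bounds the measure of the dilate, and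
  the infimum over all such balls gives the claim.\<close>

lemma mu_dist_le_delta:
  obtains C where "C \<ge> 1"
    "\<And>x y. x \<in> X \<Longrightarrow> y \<in> X \<Longrightarrow> x \<noteq> y \<Longrightarrow> mu x (d x y) \<le> C * delta x y"
proof -
  \<comment> \<open>The factor comes from two uses of the triangle inequality:
    \<open>d x y \<le> 2 * K * r\<close>, and then \<open>d z w < K * (r + 2 * K * r)\<close> for
    \<open>w\<close> in \<open>B x (d x y)\<close>.\<close>
  have l: "K * (1 + 2 * K) > 0" using K_ge_1 by simp
  obtain C where C: "C \<ge> 1"
    "\<And>x r. x \<in> X \<Longrightarrow> r > 0 \<Longrightarrow> mu x (K * (1 + 2 * K) * r) \<le> C * mu x r"
    using mu_dilate[OF l] by blast
  have "mu x (d x y) \<le> C * delta x y" if xy: "x \<in> X" "y \<in> X" "x \<noteq> y" for x y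
  proof -
    let ?S = "{mu z r | z r. z \<in> X \<and> r > 0 \<and> x \<in> B z r \<and> y \<in> B z r}"
    have "mu x (d x y) / C \<le> Inf ?S"
    proof (rule cInf_greatest)
      show "?S \<noteq> {}" by (rule balls_containing_nonempty[OF xy(1,2)])
      fix a assume "a \<in> ?S"
      then obtain z r where z: "z \<in> X" "r > 0" "x \<in> B z r" "y \<in> B z r" "a = mu z r"
        by blast
      then have dz: "d z x < r" "d z y < r" by (auto simp: qm_ball_def)
      have "d x y \<le> K * (d z x + d z y)"
        using dist_triangle[of x y z] dist_sym[of x z] xy z by auto
      also have "\<dots> \<le> K * (r + r)"
        using dz K_ge_1 by (intro mult_left_mono) auto
      finally have dxy: "d x y \<le> 2 * K * r" by simp
      have "B x (d x y) \<subseteq> B z (K * (1 + 2 * K) * r)"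
      proof
        fix w assume "w \<in> B x (d x y)"
        then have w: "w \<in> X" "d x w < d x y" by (auto simp: qm_ball_def)
        have "d z w \<le> K * (d z x + d x w)"
          using dist_triangle z w xy by blast
        also have "\<dots> < K * (r + 2 * K * r)"
          using dz w dxy K_ge_1 by (intro mult_strict_left_mono) auto
        finally show "w \<in> B z (K * (1 + 2 * K) * r)"
          using w by (simp add: qm_ball_def algebra_simps)
      qed
      then have "mu x (d x y) \<le> mu z (K * (1 + 2 * K) * r)"
        using xy z l dist_pos by (intro mu_mono) auto
      also have "\<dots> \<le> C * mu z r" using C z by blast
      finally show "mu x (d x y) / C \<le> a"
        using C(1) z by (simp add: field_simps)
    qed
    then show ?thesis using C(1) xy by (simp add: ms_delta_def field_simps)
  qed
  with C(1) show thesis by (rule that)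
qed

lemma delta_pos:
  assumes "x \<in> X" "y \<in> X" "x \<noteq> y"
  shows "0 < delta x y"
proof -
  obtain C where "C \<ge> 1" "mu x (d x y) \<le> C * delta x y"
    using mu_dist_le_delta assms by metis
  moreover have "0 < mu x (d x y)"
    using assms by (intro measure_ball_pos dist_pos)
  ultimately have "0 < C * delta x y" by linarith
  with \<open>C \<ge> 1\<close> show ?thesis by (simp add: zero_less_mult_iff)
qed

text \<open>An infimum lies below \<open>r\<close> iff some ball has measure below \<open>r\<close>.
  This makes \<open>delta\<close>-balls open, hence Borel, and shows that they contain
  \<open>B x t\<close> once \<open>mu x t < r\<close>.\<close>

lemma delta_ball_eq:
  assumes "x \<in> X" "r > 0"
  shows "qm_ball X delta x r = \<Union>{B z t | z t. z \<in> X \<and> t > 0 \<and> x \<in> B z t \<and> mu z t < r}"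
    (is "_ = ?U")
proof
  show "?U \<subseteq> qm_ball X delta x r"
  proof
    fix y assume "y \<in> ?U"
    then obtain z t where z: "z \<in> X" "t > 0" "x \<in> B z t" "mu z t < r" "y \<in> B z t"
      by blast
    with delta_le[of z t x y] show "y \<in> qm_ball X delta x r"
      by (auto simp: qm_ball_def)
  qed
  show "qm_ball X delta x r \<subseteq> ?U"
  proof
    fix y assume "y \<in> qm_ball X delta x r"
    then have y: "y \<in> X" "delta x y < r" by (auto simp: qm_ball_def)
    show "y \<in> ?U"
    proof (cases "x = y")
      case True
      \<comment> \<open>Since \<open>delta x x\<close> is 0 by definition and not an infimum, small
        balls at \<open>x\<close> have to be supplied by \<open>mu_tendsto_0\<close>.\<close>
      obtain n :: nat where "mu x (1 / 2 ^ n) < r"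
        using order_tendstoD(2)[OF mu_tendsto_0[OF assms(1) zero_less_one] assms(2)]
        by (auto simp: eventually_sequentially)
      moreover have "x \<in> B x (1 / 2 ^ n)"
        using assms by (intro centre_in_ball) auto
      ultimately show ?thesis
        using True assms by (intro UnionI[of "B x (1 / 2 ^ n)"]) (auto intro!: exI)
    next
      case False
      let ?S = "{mu z r | z r. z \<in> X \<and> r > 0 \<and> x \<in> B z r \<and> y \<in> B z r}"
      have "?S \<noteq> {}" by (rule balls_containing_nonempty[OF assms(1) y(1)])
      moreover have "Inf ?S < r" using False y by (simp add: ms_delta_def)
      ultimately obtain a where "a \<in> ?S" "a < r"
        by (meson cInf_lessD)
      then show ?thesis by blast
    qed
  qed
qed

lemma openin_delta_ball:
  assumes "x \<in> X" "r > 0"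
  shows "openin (qm_topology X d) (qm_ball X delta x r)"
  unfolding delta_ball_eq[OF assms] by (intro openin_Union) (auto intro: openin_ball)

text \<open>With equal topologies, closed sets and Borel measures are the same for \<open>d\<close>
  and \<open>delta\<close>, so the measure given for \<open>d\<close> can serve for
  \<open>delta\<close> too.\<close>

lemma qm_topology_delta: "qm_topology X delta = qm_topology X d"
proof (rule topology_eq[THEN iffD2], intro allI iffI)
  fix U assume U: "openin (qm_topology X delta) U"
  have "\<exists>t>0. B x t \<subseteq> U" if "x \<in> U" for x
  proof -
    obtain r where r: "r > 0" "qm_ball X delta x r \<subseteq> U" and x: "x \<in> X"
      using U \<open>x \<in> U\<close> unfolding openin_qm_topology by blast
    have "x \<in> qm_ball X delta x r"
      using x r by (simp add: qm_ball_def ms_delta_def)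
    then obtain t where "t > 0" "B x t \<subseteq> qm_ball X delta x r"
      using openin_delta_ball[OF x r(1)] unfolding openin_qm_topology by blast
    with r show ?thesis by blast
  qed
  with U show "openin (qm_topology X d) U" by (simp add: openin_qm_topology)
next
  fix U assume U: "openin (qm_topology X d) U"
  obtain C where C: "C \<ge> 1"
    "\<And>x y. x \<in> X \<Longrightarrow> y \<in> X \<Longrightarrow> x \<noteq> y \<Longrightarrow> mu x (d x y) \<le> C * delta x y"
    using mu_dist_le_delta by blast
  have "\<exists>e>0. qm_ball X delta x e \<subseteq> U" if "x \<in> U" for x
  proof -
    obtain r where r: "r > 0" "B x r \<subseteq> U" and x: "x \<in> X"
      using U \<open>x \<in> U\<close> unfolding openin_qm_topology by blast
    \<comment> \<open>The radius is chosen so that a point \<open>y\<close> with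
      \<open>r \<le> d x y\<close> would give
      \<open>mu x r \<le> mu x (d x y) \<le> C * delta x y < mu x r\<close>.\<close>
    have "qm_ball X delta x (mu x r / C) \<subseteq> B x r"
    proof (rule ccontr)
      assume "\<not> ?thesis"
      then obtain y where y: "y \<in> X" "delta x y < mu x r / C" "r \<le> d x y"
        by (auto simp: qm_ball_def subset_iff not_less)
      have "x \<noteq> y" using y(3) r(1) dist_eq_0[OF x y(1)] by auto
      then have "mu x (d x y) \<le> C * delta x y" using C x y by blast
      moreover have "C * delta x y < mu x r"
        using y(2) C(1) by (simp add: field_simps)
      moreover have "mu x r \<le> mu x (d x y)"
        using y r x by (intro mu_mono ball_mono) auto
      ultimately show False by linarith
    qed
    moreover have "mu x r / C > 0" using measure_ball_pos[OF x r(1)] C(1) by simp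
    ultimately show ?thesis using r by blast
  qed
  with U show "openin (qm_topology X delta) U" by (simp add: openin_qm_topology)
qed

section \<open>Unbounded sets force infinite total measure\<close>

text \<open>Otherwise \<open>F\<close> lies in \<open>B x L\<close>, and the triangle inequality
  through \<open>x\<close> bounds its diameter by \<open>2 * K * L\<close>.\<close>

lemma exists_far_point:
  assumes "F \<subseteq> X" "qm_unbounded d F" "x \<in> X"
  obtains y where "y \<in> F" "L \<le> d x y"
proof (rule ccontr)
  assume no: "\<not> thesis"
  have near: "d x y < L" if "y \<in> F" for y
    using no \<open>\<And>y. y \<in> F \<Longrightarrow> L \<le> d x y \<Longrightarrow> thesis\<close> that by force
  have "d y z \<le> K * (L + L)" if "y \<in> F" "z \<in> F" for y z
  proof -
    have "d y z \<le> K * (d y x + d x z)"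
      using dist_triangle assms that by blast
    also have "\<dots> \<le> K * (L + L)"
      using near[OF that(1)] near[OF that(2)] dist_sym[of x y] assms that K_ge_1
      by (intro mult_left_mono) auto
    finally show ?thesis .
  qed
  then have "qm_diam d F \<le> ennreal (K * (L + L))"
    unfolding qm_diam_def by (intro SUP_least ennreal_leI)
  then show False using assms(2) by (simp add: qm_unbounded_def top_unique)
qed

text \<open>A ball at \<open>x\<close> and a disjoint ball at a far point \<open>y\<close>, both of radius comparable to \<open>d x y\<close>, have
  comparable measures, so the measure grows geometrically along a sequence of radii.\<close>

lemma mu_unbounded:
  assumes "F \<subseteq> X" "qm_unbounded d F" "x \<in> X"
  obtains T where "T > 0" "b \<le> mu x T"
proof -
  \<comment> \<open>Below, \<open>D = 2 * K * q\<close>, so dilation by \<open>4 * K * K\<close>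
    turns radius \<open>q\<close> into \<open>2 * K * D\<close>, which is large enough for a ball at
    either of \<open>x\<close>, \<open>y\<close> to contain the \<open>q\<close>-ball at the
    other.\<close>
  have l: "4 * K * K > 0" using K_ge_1 by simp
  obtain C where C: "C \<ge> 1"
    "\<And>x r. x \<in> X \<Longrightarrow> r > 0 \<Longrightarrow> mu x (4 * K * K * r) \<le> C * mu x r"
    using mu_dilate[OF l] by blast
  have step: "\<exists>r'>0. (1 + 1 / C) * mu x r \<le> mu x r'" if r: "r > 0" for r
  proof -
    obtain y where "y \<in> F" and far: "2 * K * r \<le> d x y"
      using exists_far_point[OF assms] by blast
    define D where "D = d x y"
    \<comment> \<open>With this radius a common point of the balls at \<open>x\<close> and
      \<open>y\<close> would give \<open>D < K * (q + q) = D\<close>; taking \<open>y\<close> at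
      distance at least \<open>2 * K * r\<close> ensures \<open>r \<le> q\<close>.\<close>
    define q where "q = D / (2 * K)"
    have y: "y \<in> X" using \<open>y \<in> F\<close> assms(1) by blast
    have q: "r \<le> q" "q > 0" and D: "D = 2 * K * q" "D > 0" "q \<le> D" and dyx: "d y x = D"
    proof -
      show "r \<le> q" using far K_ge_1 by (simp add: q_def D_def field_simps)
      then show "q > 0" using r by simp
      show "D = 2 * K * q" using K_ge_1 by (simp add: q_def)
      then show "D > 0" using \<open>q > 0\<close> K_ge_1 by simp
      have "1 * q \<le> 2 * K * q" using K_ge_1 \<open>q > 0\<close> by (intro mult_right_mono) auto
      then show "q \<le> D" using \<open>D = 2 * K * q\<close> by simp
      show "d y x = D" using dist_sym[OF assms(3) y] by (simp add: D_def)
    qed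
    have qless: "q < D"
    proof -
      have "2 * q \<le> 2 * K * q" using K_ge_1 q by (intro mult_right_mono) auto
      then show ?thesis using D(1) q by simp
    qed
    have near: "d u w < 2 * K * D" if "u \<in> X" "v \<in> X" "w \<in> X" "d u v = D" "d v w < q" for u v w
    proof -
      have "d u w \<le> K * (d u v + d v w)" using dist_triangle that by blast
      also have "\<dots> < K * (D + D)"
        using that qless K_ge_1 by (intro mult_strict_left_mono) auto
      finally show ?thesis by simp
    qed
    have sub: "B x q \<subseteq> B y (2 * K * D)" "B y q \<subseteq> B x (2 * K * D)"
      using near[of y x] near[of x y] assms(3) y dyx by (auto simp: qm_ball_def D_def)
    have "1 * D \<le> 2 * K * D" using K_ge_1 D by (intro mult_right_mono) auto
    then have "q \<le> 2 * K * D" using qless by simp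
    then have sub': "B x q \<subseteq> B x (2 * K * D)" by (rule ball_mono)
    have disj: "B x q \<inter> B y q = {}"
    proof (rule ccontr)
      assume "B x q \<inter> B y q \<noteq> {}"
      then obtain w where w: "w \<in> X" "d x w < q" "d y w < q" by (auto simp: qm_ball_def)
      have "D \<le> K * (d x w + d w y)"
        unfolding D_def using dist_triangle assms(3) y w by blast
      also have "\<dots> < K * (q + q)"
        using w dist_sym[OF y w(1)] K_ge_1 by (intro mult_strict_left_mono) auto
      finally show False using D by simp
    qed
    have pos: "2 * K * D > 0" using D K_ge_1 by simp
    have eq: "4 * K * K * q = 2 * K * D" using D by simp
    have "mu x q \<le> mu y (2 * K * D)"
      using sub(1) assms(3) y q pos by (intro mu_mono)
    also have "\<dots> \<le> C * mu y q"
      using C(2)[OF y q(2)] by (simp only: eq)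
    \<comment> \<open>The ball at \<open>y\<close> carries at least the fraction
      \<open>1 / C\<close> of the measure of the ball at \<open>x\<close>. As the two are disjoint,
      a ball at \<open>x\<close> containing both gains the factor \<open>1 + 1 / C\<close>.\<close>
    finally have "mu x q / C \<le> mu y q" using C(1) by (simp add: field_simps)
    moreover have "mu x q + mu y q = measure M (B x q \<union> B y q)"
      using measure_Un3[OF fmeasurable_ball[OF assms(3) q(2)] fmeasurable_ball[OF y q(2)]] disj
      by simp
    moreover have "measure M (B x q \<union> B y q) \<le> mu x (2 * K * D)"
      using sub sub' assms(3) y q pos
      by (intro measure_mono_fmeasurable) (auto simp: fmeasurable_ball fmeasurableD)
    ultimately have "(1 + 1 / C) * mu x q \<le> mu x (2 * K * D)"
      by (simp add: algebra_simps)
    moreover have "(1 + 1 / C) * mu x r \<le> (1 + 1 / C) * mu x q"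
      using q r assms(3) C(1) by (intro mult_left_mono mu_mono ball_mono) auto
    ultimately show ?thesis using pos by (intro exI[of _ "2 * K * D"]) auto
  qed
  have iter: "\<exists>r>0. (1 + 1 / C) ^ n * mu x 1 \<le> mu x r" for n
  proof (induction n)
    case 0
    show ?case by (intro exI[of _ 1]) simp
  next
    case (Suc n)
    then obtain r where r: "r > 0" "(1 + 1 / C) ^ n * mu x 1 \<le> mu x r" by blast
    obtain r' where r': "r' > 0" "(1 + 1 / C) * mu x r \<le> mu x r'" using step r by blast
    have "(1 + 1 / C) * ((1 + 1 / C) ^ n * mu x 1) \<le> (1 + 1 / C) * mu x r"
      using r C(1) by (intro mult_left_mono) auto
    with r' show ?case by (intro exI[of _ r']) (simp add: mult.assoc)
  qed
  obtain n where n: "b / mu x 1 < (1 + 1 / C) ^ n"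
    using real_arch_pow[of "1 + 1 / C" "b / mu x 1"] C(1) by auto
  have "mu x 1 > 0" using assms(3) by (simp add: measure_ball_pos)
  then have "b \<le> (1 + 1 / C) ^ n * mu x 1" using n by (simp add: field_simps)
  with iter[of n] show thesis by (meson order_trans that)
qed

section \<open>Measure bounds on \<open>delta\<close>-balls\<close>

text \<open>Two applications of \<open>scale_exists\<close> sandwich the \<open>delta\<close>-ball:
  at level \<open>r\<close> for a \<open>d\<close>-ball inside it, at level \<open>2 * C * r\<close>
  for one around it. All radii used are at most \<open>T\<close>, where the bounds on
  \<open>m\<close> are available.\<close>

lemma delta_ball_bounds:
  assumes m: "borel_measure_on (qm_topology X d) m" and c: "c \<ge> 1" and s: "s \<ge> 0"
    and C: "C \<ge> 1"
      "\<And>x y. x \<in> X \<Longrightarrow> y \<in> X \<Longrightarrow> x \<noteq> y \<Longrightarrow> mu x (d x y) \<le> C * delta x y"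
    and x: "x \<in> X" and r: "r > 0" and T: "T > 0" "2 * C * r \<le> mu x T"
    and bounds: "\<And>t. t > 0 \<Longrightarrow> t \<le> T \<Longrightarrow>
      ennreal (inverse c * mu x t powr s) \<le> emeasure m (B x t) \<and>
      emeasure m (B x t) \<le> ennreal (c * mu x t powr s)"
  shows "ennreal (inverse (c * (2 * A * C) powr s) * r powr s)
           \<le> emeasure m (qm_ball X delta x r)"
    and "emeasure m (qm_ball X delta x r) \<le> ennreal (c * (2 * A * C) powr s * r powr s)"
proof -
  have Cr: "r \<le> C * r" "C * r < 2 * C * r" using C(1) r by auto
  \<comment> \<open>The inner ball costs the factor \<open>A\<close>, the outer one
    \<open>2 * A * C\<close>; the larger factor serves for both bounds.\<close>
  have CA: "A \<le> 2 * A * C"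
  proof -
    have "A * 1 \<le> A * (2 * C)" using A_ge_1 C(1) by (intro mult_left_mono) auto
    then show ?thesis by simp
  qed
  show "ennreal (inverse (c * (2 * A * C) powr s) * r powr s)
           \<le> emeasure m (qm_ball X delta x r)"
  proof -
    obtain t where t: "t > 0" "2 * t \<le> T" "mu x t < r" "r \<le> mu x (2 * t)"
      using scale_exists[OF x T(1) r] Cr T by auto
    have "r \<le> A * mu x t" using t measure_ball_double[OF x t(1)] by linarith
    also have "\<dots> \<le> (2 * A * C) * mu x t" using CA by (intro mult_right_mono) auto
    finally have "r powr s \<le> ((2 * A * C) * mu x t) powr s"
      using r s by (intro powr_mono2) auto
    also have "\<dots> = (2 * A * C) powr s * mu x t powr s"
      using A_ge_1 C(1) by (intro powr_mult)
    finally have le: "r powr s \<le> (2 * A * C) powr s * mu x t powr s" .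
    have "(2 * A * C) powr s > 0" using A_ge_1 C(1) by simp
    with le c have "inverse (c * (2 * A * C) powr s) * r powr s \<le> inverse c * mu x t powr s"
      by (simp add: field_simps)
    then have "ennreal (inverse (c * (2 * A * C) powr s) * r powr s)
        \<le> ennreal (inverse c * mu x t powr s)"
      by (rule ennreal_leI)
    also have "\<dots> \<le> emeasure m (B x t)" using bounds t by auto
    also have "\<dots> \<le> emeasure m (qm_ball X delta x r)"
    proof (rule emeasure_mono)
      show "B x t \<subseteq> qm_ball X delta x r"
        unfolding delta_ball_eq[OF x r] using centre_in_ball[OF x t(1)] x t by blast
      show "qm_ball X delta x r \<in> sets m"
        by (intro sets_openin[OF m] openin_delta_ball x r)
    qed
    finally show ?thesis .
  qed
  show "emeasure m (qm_ball X delta x r) \<le> ennreal (c * (2 * A * C) powr s * r powr s)"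
  proof -
    obtain t where t: "t > 0" "2 * t \<le> T" "mu x t < 2 * C * r" "2 * C * r \<le> mu x (2 * t)"
      using scale_exists[OF x T(1) _ T(2)] Cr r by auto
    \<comment> \<open>A point outside would give
      \<open>mu x (2 * t) \<le> mu x (d x y) \<le> C * r\<close>, strictly below the level
      \<open>2 * C * r\<close> that \<open>mu x (2 * t)\<close> reaches.\<close>
    have sub: "qm_ball X delta x r \<subseteq> B x (2 * t)"
    proof (rule ccontr)
      assume "\<not> ?thesis"
      then obtain y where y: "y \<in> X" "delta x y < r" "2 * t \<le> d x y"
        by (auto simp: qm_ball_def subset_iff not_less)
      have "x \<noteq> y" using y(3) t(1) dist_eq_0[OF x y(1)] by auto
      then have "mu x (d x y) \<le> C * delta x y" using C x y by blast
      also have "\<dots> \<le> C * r" using y C(1) by simp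
      finally have "mu x (d x y) < 2 * C * r" using Cr by simp
      moreover have "mu x (2 * t) \<le> mu x (d x y)"
        using y t x by (intro mu_mono ball_mono) auto
      ultimately show False using t by simp
    qed
    have "emeasure m (qm_ball X delta x r) \<le> emeasure m (B x (2 * t))"
      using sub t x by (intro emeasure_mono sets_openin[OF m] openin_ball) auto
    also have "\<dots> \<le> ennreal (c * mu x (2 * t) powr s)"
      using bounds t by auto
    also have "\<dots> \<le> ennreal (c * (2 * A * C) powr s * r powr s)"
    proof (rule ennreal_leI)
      have "mu x (2 * t) \<le> A * mu x t" using measure_ball_double[OF x t(1)] .
      also have "\<dots> \<le> A * (2 * C * r)" using t A_ge_1 by (intro mult_left_mono) auto
      finally have "mu x (2 * t) powr s \<le> (2 * A * C * r) powr s"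
        using s by (intro powr_mono2) (auto simp: mult_ac)
      also have "\<dots> = (2 * A * C) powr s * r powr s"
        using A_ge_1 C(1) r by (intro powr_mult)
      finally show "c * mu x (2 * t) powr s \<le> c * (2 * A * C) powr s * r powr s"
        using c by simp
    qed
    finally show ?thesis .
  qed
qed

lemma const_ge_1:
  assumes "c \<ge> 1" "C \<ge> 1" "s \<ge> 0"
  shows "c * (2 * A * C) powr s \<ge> 1"
proof -
  have "1 \<le> A * C" using A_ge_1 assms mult_mono[of 1 A 1 C] by simp
  then have "1 \<le> (2 * A * C) powr s" using assms by (intro ge_one_powr_ge_zero) auto
  then show ?thesis using assms mult_mono[of 1 c 1 "(2 * A * C) powr s"] by simp
qed

section \<open>The unbounded and the local case\<close>

text \<open>Infinite diameter makes the bounds on \<open>m\<close> valid at all radii, so the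
  \<open>T\<close> from \<open>mu_unbounded\<close> may be as large as \<open>r\<close>
  requires.\<close>

lemma unbounded_s_set:
  assumes "qm_unbounded d F" "s_set_wrt X d M s F" "s \<ge> 0"
  shows "s_set X delta s F"
proof -
  obtain C where C: "C \<ge> 1"
    "\<And>x y. x \<in> X \<Longrightarrow> y \<in> X \<Longrightarrow> x \<noteq> y \<Longrightarrow> mu x (d x y) \<le> C * delta x y"
    using mu_dist_le_delta by blast
  obtain m c where m: "borel_measure_on (qm_topology X d) m" "supported_on m F" "c \<ge> 1"
    and bounds: "\<And>x t. x \<in> F \<Longrightarrow> t > 0 \<Longrightarrow>
      ennreal (inverse c * mu x t powr s) \<le> emeasure m (B x t) \<and>
      emeasure m (B x t) \<le> ennreal (c * mu x t powr s)"
    using assms(1,2) unfolding s_set_wrt_def qm_unbounded_def by auto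
  have F: "closedin (qm_topology X d) F"
    using assms(2) by (simp add: s_set_wrt_def)
  then have FX: "F \<subseteq> X"
    using closedin_subset topspace_qm_topology by metis
  have "ennreal (inverse (c * (2 * A * C) powr s) * r powr s) \<le> emeasure m (qm_ball X delta x r) \<and>
        emeasure m (qm_ball X delta x r) \<le> ennreal (c * (2 * A * C) powr s * r powr s)"
    if "x \<in> F" "r > 0" for x r
  proof -
    have "x \<in> X" using that FX by blast
    obtain T where T: "T > 0" "2 * C * r \<le> mu x T"
      using mu_unbounded[OF FX assms(1) \<open>x \<in> X\<close>] by blast
    show ?thesis
      using delta_ball_bounds[OF m(1,3) assms(3) C \<open>x \<in> X\<close> that(2) T] bounds[OF that(1)] by blast
  qed
  then show ?thesis
    unfolding s_set_def qm_topology_delta using F m const_ge_1[OF m(3) C(1) assms(3)] by blast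
qed

text \<open>Only radii below \<open>r0\<close> are admissible, so \<open>T\<close> is fixed;
  consistency, moved from \<open>R\<close> to \<open>T\<close> by doubling, bounds
  \<open>mu x T\<close> below uniformly on \<open>F\<close>.\<close>

lemma consistent_locally_s_set:
  assumes "locally_s_set_wrt X d M s F" "consistent_with X d M F" "s \<ge> 0"
  shows "locally_s_set X delta s F"
proof -
  obtain C where C: "C \<ge> 1"
    "\<And>x y. x \<in> X \<Longrightarrow> y \<in> X \<Longrightarrow> x \<noteq> y \<Longrightarrow> mu x (d x y) \<le> C * delta x y"
    using mu_dist_le_delta by blast
  obtain m c r0 where m: "borel_measure_on (qm_topology X d) m" "supported_on m F" "c \<ge> 1"
    and r0: "r0 > 0" "ennreal r0 < qm_diam d F"
    and bounds: "\<And>x t. x \<in> F \<Longrightarrow> t > 0 \<Longrightarrow> t < r0 \<Longrightarrow>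
      ennreal (inverse c * mu x t powr s) \<le> emeasure m (B x t) \<and>
      emeasure m (B x t) \<le> ennreal (c * mu x t powr s)"
    using assms(1) unfolding locally_s_set_wrt_def by blast
  have F: "closedin (qm_topology X d) F"
    using assms(1) by (simp add: locally_s_set_wrt_def)
  then have FX: "F \<subseteq> X"
    using closedin_subset topspace_qm_topology by metis
  \<comment> \<open>Two distinct points of \<open>F\<close> make its \<open>delta\<close>-diameter
    positive, leaving room for the new threshold \<open>r1\<close>.\<close>
  obtain x0 y0 where xy: "x0 \<in> F" "y0 \<in> F" "x0 \<noteq> y0"
  proof -
    obtain x0 y0 where "x0 \<in> F" "y0 \<in> F" "ennreal r0 < ennreal (d x0 y0)"
      using r0(2) by (auto simp: qm_diam_def less_SUP_iff)
    moreover from this have "x0 \<noteq> y0" using r0(1) dist_eq_0[of x0 x0] FX by auto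
    ultimately show thesis using that by blast
  qed
  obtain R where R: "R > 0" "0 < (INF x\<in>F. emeasure M (B x R))"
    using assms(2) by (auto simp: consistent_with_def)
  have emeasure_eq: "emeasure M (B x t) = ennreal (mu x t)" if "x \<in> X" "t > 0" for x t
    using emeasure_ball_finite[OF that] by (simp add: emeasure_eq_ennreal_measure)
  define T where "T = r0 / 2"
  have T: "T > 0" "T < r0" using r0 by (auto simp: T_def)
  \<comment> \<open>A value strictly between 0 and the infimum is finite because \<open>F\<close> is
    nonempty, so it yields a real lower bound.\<close>
  obtain a where a: "a > 0" "\<And>x. x \<in> F \<Longrightarrow> a \<le> mu x R"
  proof -
    obtain e where e: "0 < e" "e < (INF x\<in>F. emeasure M (B x R))"
      using dense[OF R(2)] by blast
    have le: "e \<le> ennreal (mu x R)" if "x \<in> F" for x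
      using e INF_lower[OF that, of "\<lambda>x. emeasure M (B x R)"] emeasure_eq[of x R] that FX R
      by (auto simp: subset_iff)
    then have "e < \<infinity>" 
      using order_le_less_trans[OF le[OF xy(1)] ennreal_less_top] by simp
    show thesis
    proof
      show "enn2real e > 0" using e \<open>e < \<infinity>\<close> by (simp add: enn2real_positive_iff)
      show "enn2real e \<le> mu x R" if "x \<in> F" for x
        using le[OF that] by (intro enn2real_leI) auto
    qed
  qed
  obtain D where D: "D \<ge> 1" "\<And>x r. x \<in> X \<Longrightarrow> r > 0 \<Longrightarrow> mu x (R / T * r) \<le> D * mu x r"
    using mu_dilate[of "R / T"] R T by auto
  have aT: "a / D \<le> mu x T" if "x \<in> F" for x
  proof -
    have "R / T * T = R" using T by simp
    then have "a \<le> D * mu x T" using D(2)[of x T] a(2)[OF that] FX T that by fastforce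
    then show ?thesis using D(1) by (simp add: field_simps)
  qed
  \<comment> \<open>The first term ensures \<open>2 * C * r \<le> mu x T\<close> for
    \<open>r < r1\<close>, the second puts \<open>r1\<close> strictly below the
    \<open>delta\<close>-diameter of \<open>F\<close>.\<close>
  define r1 where "r1 = min (a / D / (2 * C)) (delta x0 y0 / 2)"
  have pos: "delta x0 y0 > 0" using xy FX by (intro delta_pos) auto
  have r1: "r1 > 0" using pos a C D by (simp add: r1_def)
  have "ennreal r1 < ennreal (delta x0 y0)"
    using r1 pos by (intro ennreal_lessI) (auto simp: r1_def)
  also have "\<dots> \<le> qm_diam delta F"
    unfolding qm_diam_def using xy by (meson SUP_upper2 order_refl)
  finally have r1_diam: "ennreal r1 < qm_diam delta F" .
  have "ennreal (inverse (c * (2 * A * C) powr s) * r powr s) \<le> emeasure m (qm_ball X delta x r) \<and>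
        emeasure m (qm_ball X delta x r) \<le> ennreal (c * (2 * A * C) powr s * r powr s)"
    if "x \<in> F" "r > 0" "r < r1" for x r
  proof -
    have "x \<in> X" using that FX by blast
    have "r \<le> a / D / (2 * C)" using that by (simp add: r1_def)
    then have "2 * C * r \<le> a / D" using C(1) D(1) by (simp add: field_simps)
    then have "2 * C * r \<le> mu x T" using aT[OF that(1)] by linarith
    moreover have "t < r0" if "t \<le> T" for t using that T by simp
    ultimately show ?thesis
      using delta_ball_bounds[OF m(1,3) assms(3) C \<open>x \<in> X\<close> that(2) T(1)] bounds[OF that(1)]
      by blast
  qed
  then show ?thesis
    unfolding locally_s_set_def qm_topology_delta
    using F m const_ge_1[OF m(3) C(1) assms(3)] r1 r1_diam by blast
qed

end

section \<open>From the definition to fixed constants\<close>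

lemma homogeneous_space_exists:
  assumes "space_of_homogeneous_type X d M"
  obtains K A where "homogeneous_space X d M K A"
proof -
  have q: "quasi_metric_on X d" and "doubling X d M" and na: "non_atomic X M"
    using assms by (auto simp: space_of_homogeneous_type_def)
  obtain K where K: "K \<ge> 1" "\<forall>x\<in>X. \<forall>y\<in>X. \<forall>z\<in>X. d x y \<le> K * (d x z + d z y)"
    using q by (auto simp: quasi_metric_on_def)
  obtain A :: real where A: "A \<ge> 1" and
    dbl: "\<And>x r. x \<in> X \<Longrightarrow> r > 0 \<Longrightarrow>
      0 < emeasure M (qm_ball X d x (2 * r)) \<and>
      emeasure M (qm_ball X d x (2 * r)) \<le> ennreal A * emeasure M (qm_ball X d x r) \<and>
      ennreal A * emeasure M (qm_ball X d x r) < \<infinity>"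
    using \<open>doubling X d M\<close> unfolding doubling_def by blast
  \<comment> \<open>The doubling condition asserts positivity at radius \<open>2 * r\<close>;
    applied at \<open>r / 2\<close> it gives both positivity and finiteness at
    \<open>r\<close>.\<close>
  have pos: "0 < emeasure M (qm_ball X d x r)" and fin: "emeasure M (qm_ball X d x r) < \<infinity>"
    if "x \<in> X" "r > 0" for x r
    using dbl[of x "r / 2"] that order.strict_trans1 by auto
  show thesis
  proof (rule that, unfold_locales)
    fix x r assume x: "x \<in> X" and r: "(r::real) > 0"
    have eq: "emeasure M (qm_ball X d x t) = ennreal (measure M (qm_ball X d x t))"
      if "t > 0" for t
      using fin[OF x that] by (simp add: emeasure_eq_ennreal_measure)
    show "0 < measure M (qm_ball X d x r)"
      using pos[OF x r] eq[OF r] by simp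
    have "2 * r > 0" using r by simp
    have "ennreal (measure M (qm_ball X d x (2 * r)))
        \<le> ennreal (A * measure M (qm_ball X d x r))"
      using dbl[OF x r] eq[OF r] eq[OF \<open>2 * r > 0\<close>] A by (simp add: ennreal_mult)
    then show "measure M (qm_ball X d x (2 * r)) \<le> A * measure M (qm_ball X d x r)"
      using A by simp
    show "emeasure M (qm_ball X d x r) < \<infinity>" using fin[OF x r] .
    show "openin (qm_topology X d) (qm_ball X d x r)"
      using assms x r by (simp add: space_of_homogeneous_type_def)
  next
    show "borel_measure_on (qm_topology X d) M"
      using assms by (simp add: space_of_homogeneous_type_def)
  qed (use q K A na in \<open>auto simp: quasi_metric_on_def non_atomic_def\<close>)
qed

theorem theorem2p5:
  fixes X :: "'a set" and d :: "'a \<Rightarrow> 'a \<Rightarrow> real" and M :: "'a measure"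
    and s :: real and F :: "'a set"
  assumes "space_of_homogeneous_type X d M"
    and "s \<ge> 0"
    and "closedin (qm_topology X d) F"
  shows "(qm_unbounded d F \<and> s_set_wrt X d M s F \<longrightarrow> s_set X (ms_delta X d M) s F) \<and>
         (locally_s_set_wrt X d M s F \<and> consistent_with X d M F \<longrightarrow>
            locally_s_set X (ms_delta X d M) s F)"
proof -
  obtain K A where "homogeneous_space X d M K A"
    using homogeneous_space_exists[OF assms(1)] .
  then interpret homogeneous_space X d M K A .
  show ?thesis
    using unbounded_s_set consistent_locally_s_set assms(2) by blast
qed

end
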